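(* (i) Let $\mathbf x_0\in\mathbb R^2$, $L>0$, and let $u\in C(\overline B_L(\mathbf x_0))\cap C^\infty(B_L(\mathbf x_0))$ satisfy $\Delta u=0$ in $B_L(\mathbf x_0)$. Then for any $r\in[0,L)$ and $\alpha_1,\alpha_2\in\mathbb N\cup\{0\}$, $$\|D^{(\alpha_1,\alpha_2)}u\|_{C(\overline B_r(\mathbf x_0))}\le D^{(\alpha_1,\alpha_2)}\left(\frac{-1}{2\pi L}\int_{\partial B_L(\mathbf x_0)}u\,ds\right)+\frac{(\alpha_1+\alpha_2)!}{\pi(L-r)^{\alpha_1+\alpha_2+1}}\int_{\partial B_L(\mathbf x_0)}|u|\,ds .$$ In particular, if $\alpha_1+\alpha_2\ge1$, then $$|D^{(\alpha_1,\alpha_2)}u(\mathbf x_0)|\le\frac{(\alpha_1+\alpha_2)!}{\pi L^{\alpha_1+\alpha_2+1}}\int_{\partial B_L(\mathbf x_0)}|u|\,ds\le\frac{2(\alpha_1+\alpha_2)!}{L^{\alpha_1+\alpha_2}}\|u\|_{C(\overline B_L(\mathbf x_0))}.$$ (ii) Let $R>0$, $g\in C(\partial B_R)$, and let $u\in C(\overline B_R)\cap C^\infty(B_R)$ be the unique solution to $\Delta u=0$ in $B_R$, $u=g$ on $\partial B_R$. Then for any $\mathbf x\in B_R$ and $\alpha_1,\alpha_2\in\mathbb N\cup\{0\}$ with $\alpha_1+\alpha_2\ge1$, $$|D^{(\alpha_1,\alpha_2)}u(\mathbf x)|\le\frac{(\alpha_1+\alpha_2)!}{\pi(R-\|\mathbf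 x\|)^{\alpha_1+\alpha_2+1}}\int_{\partial B_{R-\|\mathbf x\|}(\mathbf x)}|u|\,ds\le\frac{2(\alpha_1+\alpha_2)!}{(R-\|\mathbf x\|)^{\alpha_1+\alpha_2}}\|u\|_{C(\overline B_{R-\|\mathbf x\|}(\mathbf x))}\le\frac{2(\alpha_1+\alpha_2)!}{(R-\|\mathbf x\|)^{\alpha_1+\alpha_2}}\|g\|_{C(\partial B_R)} .$$
   Context: $\|\cdot\|$ is the Euclidean norm on $\mathbb R^2$; $B_L(\mathbf x_0)$, $\overline B_L(\mathbf x_0)$, $\partial B_L(\mathbf x_0)$ are the open disk, closed disk and circle of radius $L$ centered at $\mathbf x_0$; $B_R=B_R(\mathbf 0)$ etc. $ds$ is arc length, $\Delta=\partial_x^2+\partial_y^2$, $D^{(\alpha_1,\alpha_2)}=\partial_x^{\alpha_1}\partial_y^{\alpha_2}$. For compact $K$, $\|w\|_{C(K)}=\max_K|w|$, and $\|D^{(\alpha_1,\alpha_2)}u\|_{C(\overline B_0(\mathbf x_0))}:=|D^{(\alpha_1,\alpha_2)}u(\mathbf x_0)|$. In $D^{(\alpha_1,\alpha_2)}\big(\frac{-1}{2\pi L}\int_{\partial B_L(\mathbf x_0)}u\,ds\big)$ the operator acts on a constant function of $(x,y)$: it equals that constant if $\alpha_1=\alpha_2=0$ and $0$ otherwise. *)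

theory Defs
  imports "HOL-Analysis.Analysis"
begin

text \<open>
  The Euclidean plane is \<open>real \<times> real\<close>, whose norm is the Euclidean norm. A function
  on a subset of the plane is a total function, and only its values on that subset matter: every
  derivative below is taken at a point of an open set on which the function is given.
\<close>

definition partial_x :: "(real \<times> real \<Rightarrow> real) \<Rightarrow> real \<times> real \<Rightarrow> real" where
  "partial_x f p = deriv (\<lambda>t. f (t, snd p)) (fst p)"

definition partial_y :: "(real \<times> real \<Rightarrow> real) \<Rightarrow> real \<times> real \<Rightarrow> real" where
  "partial_y f p = deriv (\<lambda>t. f (fst p, t)) (snd p)"

definition D_mixed :: "nat \<Rightarrow> nat \<Rightarrow> (real \<times> real \<Rightarrow> real) \<Rightarrow> real \<times> real \<Rightarrow> real" where
  "D_mixed a1 a2 f = (partial_x ^^ a1) ((partial_y ^^ a2) f)"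

definition laplacian :: "(real \<times> real \<Rightarrow> real) \<Rightarrow> real \<times> real \<Rightarrow> real" where
  "laplacian f p = D_mixed 2 0 f p + D_mixed 0 2 f p"

text \<open>
  \<open>C_k_on k S f\<close> is meant for open \<open>S\<close>: all partial derivatives of \<open>f\<close> up to order \<open>k\<close>,
  in any order of differentiation, exist on \<open>S\<close> and are continuous there. Existence has to be
  required explicitly, because \<^const>\<open>deriv\<close> is total.
\<close>

primrec C_k_on :: "nat \<Rightarrow> (real \<times> real) set \<Rightarrow> (real \<times> real \<Rightarrow> real) \<Rightarrow> bool" where
  "C_k_on 0 S f \<longleftrightarrow> continuous_on S f"
| "C_k_on (Suc k) S f \<longleftrightarrow>
     continuous_on S f \<and>
     (\<forall>p\<in>S. (\<lambda>t. f (t, snd p)) differentiable (at (fst p)) \<and>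
            (\<lambda>t. f (fst p, t)) differentiable (at (snd p))) \<and>
     C_k_on k S (partial_x f) \<and> C_k_on k S (partial_y f)"

definition C_infinity_on :: "(real \<times> real) set \<Rightarrow> (real \<times> real \<Rightarrow> real) \<Rightarrow> bool" where
  "C_infinity_on S f \<longleftrightarrow> (\<forall>k. C_k_on k S f)"

text \<open>
  The norm of \<open>C(K)\<close>, for nonempty compact \<open>K\<close> and \<open>w\<close> continuous on \<open>K\<close>; the supremum is then
  a maximum, as the lemma after the definition shows.
\<close>

definition C_norm :: "(real \<times> real) set \<Rightarrow> (real \<times> real \<Rightarrow> real) \<Rightarrow> real" where
  "C_norm K w = (SUP p\<in>K. \<bar>w p\<bar>)"

lemma C_norm_attained:
  assumes "compact K" "K \<noteq> {}" "continuous_on K w"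
  shows "\<exists>p\<in>K. C_norm K w = \<bar>w p\<bar> \<and> (\<forall>q\<in>K. \<bar>w q\<bar> \<le> \<bar>w p\<bar>)"
proof -
  have "continuous_on K (\<lambda>p. \<bar>w p\<bar>)"
    using assms(3) by (rule continuous_on_rabs)
  then obtain p where p: "p \<in> K" "\<forall>q\<in>K. \<bar>w q\<bar> \<le> \<bar>w p\<bar>"
    using continuous_attains_sup[OF assms(1,2)] by blast
  then have "C_norm K w = \<bar>w p\<bar>"
    unfolding C_norm_def by (intro cSup_eq_maximum) auto
  with p show ?thesis by blast
qed

text \<open>Integral with respect to arc length along a path parametrized by \<open>[0, 1]\<close>.\<close>

definition arc_length_integral ::
    "(real \<Rightarrow> real \<times> real) \<Rightarrow> (real \<times> real \<Rightarrow> real) \<Rightarrow> real" where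
  "arc_length_integral \<gamma> w =
     integral {0..1} (\<lambda>t. w (\<gamma> t) * norm (vector_derivative \<gamma> (at t within {0..1})))"

definition circle_path :: "real \<times> real \<Rightarrow> real \<Rightarrow> real \<Rightarrow> real \<times> real" where
  "circle_path c L t = c + L *\<^sub>R (cos (2 * pi * t), sin (2 * pi * t))"

definition circle_integral ::
    "real \<times> real \<Rightarrow> real \<Rightarrow> (real \<times> real \<Rightarrow> real) \<Rightarrow> real" where
  "circle_integral c L w = arc_length_integral (circle_path c L) w"

definition harmonic_in_disk ::
    "real \<times> real \<Rightarrow> real \<Rightarrow> (real \<times> real \<Rightarrow> real) \<Rightarrow> bool" where
  "harmonic_in_disk c L u \<longleftrightarrow>
     continuous_on (cball c L) u \<and> C_infinity_on (ball c L) u \<and>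
     (\<forall>p\<in>ball c L. laplacian u p = 0)"

definition dirichlet_solution ::
    "real \<Rightarrow> (real \<times> real \<Rightarrow> real) \<Rightarrow> (real \<times> real \<Rightarrow> real) \<Rightarrow> bool" where
  "dirichlet_solution R g u \<longleftrightarrow> harmonic_in_disk 0 R u \<and> (\<forall>p\<in>sphere 0 R. u p = g p)"

end

theory Submission
  imports Defs "HOL-Complex_Analysis.Complex_Analysis"
begin

text \<open>
  On the disk \<open>u = Re F\<close> with \<open>F\<close> holomorphic, so \<open>D\<^bsup>(a1,a2)\<^esup> u = Re (\<i>\<^bsup>a2\<^esup> F\<^bsup>(n)\<^esup>)\<close> with
  \<open>n = a1 + a2\<close>. On a circle \<open>\<bar>w - c\<bar> = \<rho> < L\<close>, adding to Cauchy's formula for \<open>F\<^bsup>(n)\<^esup>(z)\<close> the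
  corresponding integral of \<open>cnj F\<close>, which is \<open>cnj (F c)\<close> if \<open>n = 0\<close> and \<open>0\<close> otherwise, expresses
  \<open>F\<^bsup>(n)\<^esup>(z) / n!\<close>, plus \<open>cnj (F c)\<close> if \<open>n = 0\<close>, as the mean of \<open>2 u(w) (w - c) / (w - z)\<^bsup>n+1\<^esup>\<close>; here
  \<open>Re (F c)\<close> is the mean of \<open>u\<close>. The kernel is at most \<open>\<rho> / (\<rho> - r)\<^bsup>n+1\<^esup>\<close> in modulus; for \<open>n = 0\<close> so is \<open>1\<close>
  minus the kernel, which bounds \<open>-u\<close> as well. Letting \<open>\<rho> \<rightarrow> L\<close> gives the estimate.
\<close>

section \<open>Functions of class \<open>C\<^sup>k\<close> on the plane\<close>

lemma C_k_on_SucD: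
  assumes "C_k_on (Suc k) S f"
  shows "continuous_on S f" "C_k_on k S (partial_x f)" "C_k_on k S (partial_y f)"
  using assms by simp_all

lemma C_k_on_imp_continuous_on: "C_k_on k S f \<Longrightarrow> continuous_on S f"
  by (cases k) simp_all

lemma C_k_on_has_partials:
  assumes "C_k_on (Suc k) S f" "(x, y) \<in> S"
  shows "((\<lambda>t. f (t, y)) has_field_derivative partial_x f (x, y)) (at x)"
    and "((\<lambda>t. f (x, t)) has_field_derivative partial_y f (x, y)) (at y)"
proof -
  have *: "(\<lambda>t. f (t, y)) differentiable (at x)" "(\<lambda>t. f (x, t)) differentiable (at y)"
    using assms by auto
  show "((\<lambda>t. f (t, y)) has_field_derivative partial_x f (x, y)) (at x)"
    and "((\<lambda>t. f (x, t)) has_field_derivative partial_y f (x, y)) (at y)"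
    using * by (simp_all add: partial_x_def partial_y_def DERIV_deriv_iff_real_differentiable)
qed

lemma C_k_on_subset: "C_k_on k S f \<Longrightarrow> T \<subseteq> S \<Longrightarrow> C_k_on k T f"
  by (induction k arbitrary: f) (auto intro: continuous_on_subset)

text \<open>The two partials combine into a total derivative because \<open>partial_y f\<close> is
  continuous near the point. The total derivative is what composition with a complex variable
  requires.\<close>

lemma C_k_on_has_derivative:
  assumes "open S" "p \<in> S" "C_k_on (Suc k) S f"
  shows "(f has_derivative (\<lambda>h. partial_x f p * fst h + partial_y f p * snd h)) (at p)"
proof -
  obtain x y where p: "p = (x, y)" by fastforce
  obtain X Y where "open X" "open Y" "(x, y) \<in> X \<times> Y" "X \<times> Y \<subseteq> S"
    using open_prod_elim[OF assms(1,2)] unfolding p by blast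
  then have XY: "open X" "open Y" "x \<in> X" "y \<in> Y" "X \<times> Y \<subseteq> S" by simp_all
  \<comment> \<open>\<open>Y\<close> is shrunk to an interval because the rule on partial
    derivatives asks for a convex second factor.\<close>
  obtain e where e: "e > 0" "ball y e \<subseteq> Y"
    using XY(2,4) openE by blast
  define Z where "Z = ball y e"
  have Z: "open Z" "y \<in> Z" "convex Z" "X \<times> Z \<subseteq> S"
    using e XY unfolding Z_def by auto
  have "((\<lambda>(x, y). f (x, y)) has_derivative
      (\<lambda>(tx, ty). partial_x f (x, y) * tx +
        blinfun_apply (partial_y f (x, y) *\<^sub>R id_blinfun) ty)) (at (x, y) within X \<times> Z)"
  proof (rule has_derivative_partialsI)
    show "((\<lambda>x. f (x, y)) has_derivative (*) (partial_x f (x, y))) (at x within X)"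
      using C_k_on_has_partials(1)[OF assms(3)] assms(2) p
      by (auto simp: has_field_derivative_def intro: has_derivative_at_withinI)
    show "((\<lambda>y. f (x, y)) has_derivative blinfun_apply (partial_y f (x, y) *\<^sub>R id_blinfun))
        (at y within Z)" if "x \<in> X" "y \<in> Z" for x y
    proof -
      have "blinfun_apply (partial_y f (x, y) *\<^sub>R id_blinfun) = (*) (partial_y f (x, y))"
        by (simp add: fun_eq_iff blinfun.scaleR_left)
      moreover have "(x, y) \<in> S" using that Z(4) by blast
      ultimately show ?thesis
        using C_k_on_has_partials(2)[OF assms(3), of x y]
        by (simp add: has_field_derivative_def has_derivative_at_withinI)
    qed
    have "continuous_on (X \<times> Z) (partial_y f)"
      using C_k_on_imp_continuous_on[OF C_k_on_SucD(3)[OF assms(3)]] Z(4) continuous_on_subset by blast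
    then have "continuous_on (X \<times> Z) (\<lambda>q. partial_y f q *\<^sub>R id_blinfun :: real \<Rightarrow>\<^sub>L real)"
      by (intro continuous_on_scaleR continuous_on_const)
    then show "continuous (at (x, y) within X \<times> Z)
        (\<lambda>(x, y). partial_y f (x, y) *\<^sub>R id_blinfun :: real \<Rightarrow>\<^sub>L real)"
      using XY(3) Z(2) by (simp add: continuous_on_eq_continuous_within case_prod_beta')
  qed (use Z in auto)
  moreover have "open (X \<times> Z)" "(x, y) \<in> X \<times> Z"
    using XY Z by (auto intro: open_Times)
  ultimately show ?thesis
    by (simp add: at_within_open[of _ "X \<times> Z"] p case_prod_beta' blinfun.scaleR_left)
qed

section \<open>Symmetry of mixed second derivatives\<close>

text \<open>The mean value theorem is applied in \<open>s\<close> to the difference of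
  \<open>f\<close> in \<open>t\<close>, then in \<open>t\<close> to \<open>fx s\<close>. The double
  difference is symmetric in the two variables, so exchanging their roles yields the other mixed
  derivative from the same quantity.\<close>

lemma double_difference_mvt:
  fixes f fx fxy :: "real \<Rightarrow> real \<Rightarrow> real"
  assumes "d > 0"
    and "\<And>s t. \<lbrakk>s \<in> {x..x+d}; t \<in> {y..y+d}\<rbrakk> \<Longrightarrow> ((\<lambda>s. f s t) has_field_derivative fx s t) (at s)"
    and "\<And>s t. \<lbrakk>s \<in> {x..x+d}; t \<in> {y..y+d}\<rbrakk> \<Longrightarrow> ((\<lambda>t. fx s t) has_field_derivative fxy s t) (at t)"
  shows "\<exists>s\<in>{x..x+d}. \<exists>t\<in>{y..y+d}.
    f (x+d) (y+d) - f x (y+d) - f (x+d) y + f x y = d * d * fxy s t"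
proof -
  have "\<exists>s>x. s < x + d \<and>
     (f (x+d) (y+d) - f (x+d) y) - (f x (y+d) - f x y) = ((x+d) - x) * (fx s (y+d) - fx s y)"
    by (rule MVT2) (use assms(1) in \<open>auto intro!: DERIV_diff assms(2)\<close>)
  then obtain s where s: "s \<in> {x..x+d}"
     "f (x+d) (y+d) - f (x+d) y - (f x (y+d) - f x y) = d * (fx s (y+d) - fx s y)"
    by (metis add_diff_cancel_left' atLeastAtMost_iff less_imp_le)
  have "\<exists>t>y. t < y + d \<and> fx s (y+d) - fx s y = ((y+d) - y) * fxy s t"
    by (rule MVT2) (use assms(1) s(1) in \<open>auto intro!: assms(3)\<close>)
  then obtain t where t: "t \<in> {y..y+d}" "fx s (y+d) - fx s y = d * fxy s t"
    by (metis add_diff_cancel_left' atLeastAtMost_iff less_imp_le)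
  with s show ?thesis by (intro bexI[of _ s] bexI[of _ t]) (auto simp: algebra_simps)
qed

text \<open>If the mixed derivatives differed at \<open>p\<close>, continuity would keep their
  values apart near \<open>p\<close>; yet on a small square each of them takes somewhere the value
  of the double difference divided by \<open>d * d\<close>.\<close>

lemma partial_x_partial_y_commute:
  assumes "open S" "p \<in> S" "C_k_on (Suc (Suc k)) S f"
  shows "partial_x (partial_y f) p = partial_y (partial_x f) p"
proof (rule ccontr)
  define a b where "a = partial_y (partial_x f)" and "b = partial_x (partial_y f)"
  assume "partial_x (partial_y f) p \<noteq> partial_y (partial_x f) p"
  \<comment> \<open>Half the gap between the two values, so that the
    \<open>?e\<close>-neighbourhoods of \<open>a p\<close> and \<open>b p\<close> are
    disjoint.\<close>
  then have e: "\<bar>a p - b p\<bar> / 2 > 0" (is "?e > 0") by (simp add: a_def b_def)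
  note C = C_k_on_SucD[OF assms(3)]
  have "continuous_on S a" "continuous_on S b"
    unfolding a_def b_def
    using C_k_on_imp_continuous_on C_k_on_SucD(3)[OF C(2)] C_k_on_SucD(2)[OF C(3)] by blast+
  then have "isCont a p" "isCont b p"
    using assms(1,2) by (simp_all add: continuous_on_eq_continuous_at)
  then have "\<forall>\<^sub>F q in nhds p. q \<in> S \<and> dist (a q) (a p) < ?e \<and> dist (b q) (b p) < ?e"
    using e assms(1,2) unfolding isCont_def tendsto_at_iff_tendsto_nhds
    by (intro eventually_conj tendstoD eventually_nhds_in_open) auto
  then obtain U where U: "open U" "p \<in> U"
    "\<And>q. q \<in> U \<Longrightarrow> q \<in> S \<and> dist (a q) (a p) < ?e \<and> dist (b q) (b p) < ?e"
    unfolding eventually_nhds by blast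
  obtain x y where p: "p = (x, y)" by fastforce
  obtain X Y where "open X" "open Y" "(x, y) \<in> X \<times> Y" "X \<times> Y \<subseteq> U"
    using open_prod_elim[OF U(1,2)] unfolding p by blast
  then have XY: "open X" "open Y" "x \<in> X" "y \<in> Y" "X \<times> Y \<subseteq> U" by simp_all
  obtain d1 d2 where d12: "d1 > 0" "cball x d1 \<subseteq> X" "d2 > 0" "cball y d2 \<subseteq> Y"
    using XY open_contains_cball by metis
  define d where "d = min d1 d2"
  have d: "d > 0" using d12 by (simp add: d_def)
  have sub: "(s, t) \<in> U" if "s \<in> {x..x+d}" "t \<in> {y..y+d}" for s t
  proof -
    have "s \<in> cball x d1" "t \<in> cball y d2"
      using that by (auto simp: dist_real_def d_def)
    then show ?thesis using d12 XY by blast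
  qed
  have "\<exists>s\<in>{x..x+d}. \<exists>t\<in>{y..y+d}.
    f (x+d, y+d) - f (x, y+d) - f (x+d, y) + f (x, y) = d * d * a (s, t)"
    unfolding a_def using d sub U(3)
    by (intro double_difference_mvt[where fx="\<lambda>s t. partial_x f (s, t)"]
        C_k_on_has_partials[OF assms(3)] C_k_on_has_partials[OF C(2)]) auto
  moreover have "\<exists>t\<in>{y..y+d}. \<exists>s\<in>{x..x+d}.
    f (x+d, y+d) - f (x+d, y) - f (x, y+d) + f (x, y) = d * d * b (s, t)"
    unfolding b_def using d sub U(3)
    by (intro double_difference_mvt[where f="\<lambda>t s. f (s, t)" and fx="\<lambda>t s. partial_y f (s, t)"]
        C_k_on_has_partials[OF assms(3)] C_k_on_has_partials[OF C(3)]) auto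
  ultimately obtain s t s' t' where st: "s \<in> {x..x+d}" "t \<in> {y..y+d}"
    "s' \<in> {x..x+d}" "t' \<in> {y..y+d}" "d * d * a (s, t) = d * d * b (s', t')"
    by (smt (verit, ccfv_SIG))
  then have "a (s, t) = b (s', t')" using d by simp
  moreover have "dist (a (s, t)) (a p) < ?e" "dist (b (s', t')) (b p) < ?e"
    using U(3) sub st by blast+
  ultimately show False
    unfolding dist_real_def by argo
qed

section \<open>Harmonic functions as real parts\<close>

text \<open>An isometry from the product plane, in which the theorem is stated, to the type on which
  holomorphic functions live; its inverse is written \<open>(Re z, Im z)\<close>.\<close>

definition complex_of_point :: "real \<times> real \<Rightarrow> complex" where
  "complex_of_point p = Complex (fst p) (snd p)"

lemma complex_of_point_Pair [simp]: "complex_of_point (Re z, Im z) = z"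
  by (simp add: complex_of_point_def)

lemma complex_of_point_sel [simp]:
  "Re (complex_of_point p) = fst p" "Im (complex_of_point p) = snd p"
  by (simp_all add: complex_of_point_def)

lemma dist_complex_of_point [simp]: "dist (complex_of_point p) (complex_of_point q) = dist p q"
  by (simp add: complex_of_point_def dist_complex_def dist_prod_def cmod_def dist_real_def)

lemma complex_has_derivative_Re_compose:
  fixes f :: "real \<times> real \<Rightarrow> real"
  assumes "(f has_derivative (\<lambda>h. a * fst h + b * snd h)) (at (Re z, Im z))"
  shows "((\<lambda>z. f (Re z, Im z)) has_derivative (\<lambda>h. a * Re h + b * Im h)) (at z)"
proof -
  have "((\<lambda>z. (Re z, Im z)) has_derivative (\<lambda>h. (Re h, Im h))) (at z)"
    by (auto intro!: derivative_eq_intros)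
  from has_derivative_compose[OF this assms] show ?thesis by simp
qed

text \<open>The complex derivative of the holomorphic function sought is \<open>u\<^sub>x - i u\<^sub>y\<close>.\<close>

lemma harmonic_eq_Re_holomorphic:
  assumes "C_infinity_on (ball c L) u" and harm: "\<And>p. p \<in> ball c L \<Longrightarrow> laplacian u p = 0"
  obtains F where "F holomorphic_on ball (complex_of_point c) L"
    and "\<And>p. p \<in> ball c L \<Longrightarrow> u p = Re (F (complex_of_point p))"
proof -
  define B where "B = ball (complex_of_point c) L"
  have B: "(Re z, Im z) \<in> ball c L" if "z \<in> B" for z
    using that dist_complex_of_point[of c "(Re z, Im z)"] by (simp add: B_def)
  define a b where "a = partial_x u" and "b = partial_y u"
  have C: "C_k_on k (ball c L) u" "C_k_on k (ball c L) a" "C_k_on k (ball c L) b" for k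
    using assms(1) C_k_on_SucD[of k "ball c L" u]
    unfolding C_infinity_on_def a_def b_def by blast+
  have der: "((\<lambda>z. f (Re z, Im z)) has_derivative
      (\<lambda>h. partial_x f (Re z, Im z) * Re h + partial_y f (Re z, Im z) * Im h)) (at z)"
    if "z \<in> B" "C_k_on (Suc 0) (ball c L) f" for f z
    using that by (intro complex_has_derivative_Re_compose
        C_k_on_has_derivative[where S="ball c L" and k=0] B open_ball)
  define G where "G z = of_real (a (Re z, Im z)) - \<i> * of_real (b (Re z, Im z))" for z
  have G: "(G has_field_derivative Complex (partial_x a (Re z, Im z)) (- partial_x b (Re z, Im z))) (at z)"
    if z: "z \<in> B" for z
  proof -
    \<comment> \<open>\<open>yx\<close>, the symmetry of mixed derivatives, and \<open>yy\<close>,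
      Laplace's equation, are the Cauchy-Riemann equations for \<open>G\<close>.\<close>
    have yx: "partial_y a (Re z, Im z) = partial_x b (Re z, Im z)"
      using partial_x_partial_y_commute[OF open_ball B[OF z] C(1)] unfolding a_def b_def by simp
    have yy: "partial_y b (Re z, Im z) = - partial_x a (Re z, Im z)"
      using harm[OF B[OF z]]
      by (simp add: laplacian_def D_mixed_def numeral_2_eq_2 a_def b_def)
    show ?thesis
      unfolding has_field_derivative_def G_def
      by (rule derivative_eq_intros der[OF z C(2)] der[OF z C(3)] refl)+
        (auto simp: yx yy complex_eq_iff algebra_simps)
  qed
  have "continuous_on B G"
    by (rule continuous_at_imp_continuous_on) (use G DERIV_isCont in blast)
  moreover have "G field_differentiable at z" if "z \<in> interior B - {}" for z
    using that G interior_subset unfolding field_differentiable_def by blast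
  moreover have "convex B" by (simp add: B_def)
  ultimately obtain F where "\<And>z. z \<in> B \<Longrightarrow> (F has_field_derivative G z) (at z within B)"
    using holomorphic_convex_primitive[of B "{}" G] by blast
  then have F: "(F has_field_derivative G z) (at z)" if "z \<in> B" for z
    using that at_within_open[of z B] by (metis B_def open_ball)
  \<comment> \<open>\<open>u\<close> and \<open>Re F\<close> have the same gradient, so they differ
    by a constant on the convex disk; that constant is added to \<open>F\<close> at the end.\<close>
  have "((\<lambda>z. u (Re z, Im z) - Re (F z)) has_derivative (\<lambda>h. 0)) (at z within B)" if z: "z \<in> B" for z
  proof (rule has_derivative_at_withinI)
    show "((\<lambda>z. u (Re z, Im z) - Re (F z)) has_derivative (\<lambda>h. 0)) (at z)"
      by (rule derivative_eq_intros der[OF z C(1)] F[OF z, unfolded has_field_derivative_def] refl)+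
        (auto simp: G_def a_def b_def)
  qed
  then obtain k where k: "\<forall>z\<in>B. u (Re z, Im z) - Re (F z) = k"
    using has_derivative_zero_constant[OF \<open>convex B\<close>] by blast
  show thesis
  proof (rule that[of "\<lambda>z. F z + of_real k"])
    have "F holomorphic_on B"
      using F holomorphic_on_open[of B F] by (metis B_def open_ball)
    then show "(\<lambda>z. F z + of_real k) holomorphic_on ball (complex_of_point c) L"
      unfolding B_def by (intro holomorphic_intros)
    show "u p = Re (F (complex_of_point p) + of_real k)" if "p \<in> ball c L" for p
      using k[THEN bspec, of "complex_of_point p"] that unfolding B_def
      by simp
  qed
qed

section \<open>Partial derivatives of real parts\<close>

text \<open>Along the horizontal and vertical lines through the point, the chain rule differentiates
  \<open>F\<close> to \<open>deriv F\<close> and \<open>\<i> * deriv F\<close>. Since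
  \<open>u\<close> is tied to \<open>F\<close> only on \<open>S\<close>, openness of
  \<open>S\<close> is used to make the functions agree near the point before \<open>deriv\<close> is
  compared.\<close>

lemma
  assumes S: "open S" and F: "F holomorphic_on S"
    and u: "\<And>p. complex_of_point p \<in> S \<Longrightarrow> u p = Re (F (complex_of_point p))"
    and p: "complex_of_point p \<in> S"
  shows partial_x_Re_holomorphic: "partial_x u p = Re (deriv F (complex_of_point p))"
    and partial_y_Re_holomorphic: "partial_y u p = Re (\<i> * deriv F (complex_of_point p))"
proof -
  obtain x y where xy: "p = (x, y)" by fastforce
  define D where "D = deriv F (complex_of_point p)"
  have z: "complex_of_point p = of_real x + \<i> * of_real y"
    by (simp add: xy complex_eq_iff)
  have D: "(F has_derivative (*) D) (at (complex_of_point p))"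
    using holomorphic_derivI[OF F S p] unfolding D_def has_field_derivative_def .
  have ev: "\<forall>\<^sub>F z in nhds (complex_of_point p). z \<in> S"
    using S p by (rule eventually_nhds_in_open)
  have "((\<lambda>t. of_real t + \<i> * of_real y) \<longlongrightarrow> complex_of_point p) (nhds x)"
    unfolding z by (intro tendsto_intros filterlim_ident)
  then have "\<forall>\<^sub>F t in nhds x. of_real t + \<i> * of_real y \<in> S"
    by (rule eventually_compose_filterlim[OF ev])
  then have ev_x: "\<forall>\<^sub>F t in nhds x. u (t, y) = Re (F (of_real t + \<i> * of_real y))"
    by eventually_elim (use u[of "(t, y)" for t] in \<open>simp add: complex_of_point_def Complex_eq\<close>)
  have "((\<lambda>t. of_real t + \<i> * of_real y) has_derivative of_real) (at x)"
    by (auto intro!: derivative_eq_intros)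
  from has_derivative_Re[OF has_derivative_compose[OF this D[unfolded z]]]
   have "((\<lambda>t. Re (F (of_real t + \<i> * of_real y))) has_field_derivative Re D) (at x)"
    unfolding has_field_derivative_def by (rule has_derivative_eq_rhs) auto
  then show "partial_x u p = Re D"
    unfolding partial_x_def xy fst_conv snd_conv
    by (subst deriv_cong_ev[OF ev_x refl]) (rule DERIV_imp_deriv)
  have "((\<lambda>t. of_real x + \<i> * of_real t) \<longlongrightarrow> complex_of_point p) (nhds y)"
    unfolding z by (intro tendsto_intros filterlim_ident)
  then have "\<forall>\<^sub>F t in nhds y. of_real x + \<i> * of_real t \<in> S"
    by (rule eventually_compose_filterlim[OF ev])
  then have ev_y: "\<forall>\<^sub>F t in nhds y. u (x, t) = Re (F (of_real x + \<i> * of_real t))"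
    by eventually_elim (use u[of "(x, t)" for t] in \<open>simp add: complex_of_point_def Complex_eq\<close>)
  have "((\<lambda>t. of_real x + \<i> * of_real t) has_derivative (\<lambda>h. \<i> * of_real h)) (at y)"
    by (auto intro!: derivative_eq_intros)
  from has_derivative_Re[OF has_derivative_compose[OF this D[unfolded z]]]
   have "((\<lambda>t. Re (F (of_real x + \<i> * of_real t))) has_field_derivative Re (\<i> * D)) (at y)"
    unfolding has_field_derivative_def by (rule has_derivative_eq_rhs) auto
  then show "partial_y u p = Re (\<i> * D)"
    unfolding partial_y_def xy fst_conv snd_conv
    by (subst deriv_cong_ev[OF ev_y refl]) (rule DERIV_imp_deriv)
qed

text \<open>A partial derivative of the real part of a holomorphic function is again such a real
  part, so the first-order rules iterate: each \<open>partial_y\<close> adds a factor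
  \<open>\<i>\<close> and one complex derivative, each \<open>partial_x\<close> only the
  latter.\<close>

lemma D_mixed_Re_holomorphic:
  assumes S: "open S" and F: "F holomorphic_on S"
    and u: "\<And>p. complex_of_point p \<in> S \<Longrightarrow> u p = Re (F (complex_of_point p))"
    and p: "complex_of_point p \<in> S"
  shows "D_mixed a1 a2 u p = Re (\<i> ^ a2 * (deriv ^^ (a1 + a2)) F (complex_of_point p))"
proof -
  have hol: "(\<lambda>z. c * (deriv ^^ k) F z) holomorphic_on S" for c k
    using F S by (intro holomorphic_intros)
  have deriv: "deriv (\<lambda>z. c * (deriv ^^ k) F z) z = c * (deriv ^^ Suc k) F z" if "z \<in> S" for c k z
    using holomorphic_on_imp_differentiable_at[OF holomorphic_higher_deriv[OF F S] S that]
    by (simp add: deriv_cmult)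
  have y: "(partial_y ^^ k) u p = Re (\<i> ^ k * (deriv ^^ k) F (complex_of_point p))"
    if "complex_of_point p \<in> S" for p k
    using that
  proof (induction k arbitrary: p)
    case (Suc k)
    then show ?case
      using partial_y_Re_holomorphic[OF S hol Suc.IH Suc.prems] by (simp add: deriv mult_ac)
  qed (simp add: u)
  have "(partial_x ^^ k) ((partial_y ^^ a2) u) p = Re (\<i> ^ a2 * (deriv ^^ (k + a2)) F (complex_of_point p))"
    if "complex_of_point p \<in> S" for p k
    using that
  proof (induction k arbitrary: p)
    case (Suc k)
    then show ?case
      using partial_x_Re_holomorphic[OF S hol Suc.IH Suc.prems] by (simp add: deriv)
  qed (simp add: y)
  with p show ?thesis by (simp add: D_mixed_def)
qed

section \<open>Schwarz integral formula\<close>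

lemma norm_circlepath_minus_center: "norm (circlepath c \<rho> t - c) = \<bar>\<rho>\<bar>"
proof -
  have "circlepath c \<rho> t - c = of_real \<rho> * exp (\<i> * of_real (2 * pi * t))"
    by (simp add: circlepath mult_ac)
  then show ?thesis by (simp only: norm_mult norm_exp_i_times) simp
qed

text \<open>The velocity of \<open>circlepath\<close> is \<open>2 * pi * \<i>\<close> times
  \<open>w - c\<close>; dividing by the constant turns a contour integral into a mean over the
  parameter interval.\<close>

lemma has_contour_integral_circlepath_imp_has_integral:
  assumes "(f has_contour_integral I) (circlepath c \<rho>)"
  shows "((\<lambda>t. f (circlepath c \<rho> t) * (circlepath c \<rho> t - c)) has_integral I / (2 * pi * \<i>)) {0..1}"
proof -
  define k where "k = 2 * pi * \<i>"
  have "k \<noteq> 0" by (simp add: k_def)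
  have "((\<lambda>t. f (circlepath c \<rho> t) * vector_derivative (circlepath c \<rho>) (at t within {0..1}))
      has_integral I) {0..1}"
    using assms by (simp add: has_contour_integral_def)
  moreover have "vector_derivative (circlepath c \<rho>) (at t within {0..1}) =
      k * (circlepath c \<rho> t - c)" if "t \<in> {0..1}" for t
    using that by (simp add: vector_derivative_circlepath01 k_def) (simp add: circlepath)
  ultimately have "((\<lambda>t. f (circlepath c \<rho> t) * (k * (circlepath c \<rho> t - c)))
      has_integral I) {0..1}"
    by (auto elim!: has_integral_eq[rotated])
  then have "((\<lambda>t. f (circlepath c \<rho> t) * (k * (circlepath c \<rho> t - c)) / k) has_integral I / k) {0..1}"
    by (rule has_integral_divide)
  then have "((\<lambda>t. f (circlepath c \<rho> t) * (circlepath c \<rho> t - c)) has_integral I / k) {0..1}"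
    using \<open>k \<noteq> 0\<close> by simp
  then show ?thesis unfolding k_def .
qed

lemma Cauchy_higher_derivative_circle_mean:
  assumes "continuous_on (cball c \<rho>) F" "F holomorphic_on ball c \<rho>" "z \<in> ball c \<rho>"
  shows "((\<lambda>t. F (circlepath c \<rho> t) * ((circlepath c \<rho> t - c) / (circlepath c \<rho> t - z) ^ Suc n))
      has_integral (deriv ^^ n) F z / fact n) {0..1}"
  using has_contour_integral_circlepath_imp_has_integral
      [OF Cauchy_has_contour_integral_higher_derivative_circlepath[OF assms, of n]]
  by (simp add: field_simps)

text \<open>The Cauchy formula with \<open>n = 0\<close> and \<open>z = c\<close>, where the kernel
  is identically \<open>1\<close> on the circle.\<close>

lemma holomorphic_circle_mean:
  assumes "continuous_on (cball c \<rho>) F" "F holomorphic_on ball c \<rho>" "0 < \<rho>"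
  shows "((\<lambda>t. F (circlepath c \<rho> t)) has_integral F c) {0..1}"
proof -
  have "((\<lambda>t. F (circlepath c \<rho> t) * ((circlepath c \<rho> t - c) / (circlepath c \<rho> t - c) ^ Suc 0))
      has_integral (deriv ^^ 0) F c / fact 0) {0..1}"
    using assms by (intro Cauchy_higher_derivative_circle_mean) auto
  moreover have "circlepath c \<rho> t - c \<noteq> 0" for t
    using norm_circlepath_minus_center[of c \<rho> t] assms(3) by auto
  ultimately show ?thesis by simp
qed

text \<open>On the circle \<open>cnj (w - c) = \<rho>\<^sup>2 / (w - c)\<close>, so the conjugate of the Cauchy kernel extends
  holomorphically to the disk, and the integral is the value of a holomorphic function at \<open>c\<close>.\<close>

lemma Cauchy_higher_derivative_circle_mean_cnj:
  assumes "continuous_on (cball c \<rho>) F" "F holomorphic_on ball c \<rho>" "z \<in> ball c \<rho>"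
  shows "((\<lambda>t. cnj (F (circlepath c \<rho> t)) * ((circlepath c \<rho> t - c) / (circlepath c \<rho> t - z) ^ Suc n))
      has_integral (if n = 0 then cnj (F c) else 0)) {0..1}"
proof -
  define \<zeta> where "\<zeta> = z - c"
  have \<zeta>: "norm \<zeta> < \<rho>" using assms(3) by (simp add: \<zeta>_def dist_norm norm_minus_commute)
  then have \<rho>: "0 < \<rho>" by (meson le_less_trans norm_ge_zero)
  \<comment> \<open>The denominator of \<open>h\<close> below can vanish only at the mirror image of
    \<open>z\<close> in the circle, which lies outside the closed disk because
    \<open>norm \<zeta> < \<rho>\<close>.\<close>
  have nz: "of_real (\<rho>\<^sup>2) - cnj \<zeta> * (w - c) \<noteq> 0" if "w \<in> cball c \<rho>" for w
  proof
    assume "of_real (\<rho>\<^sup>2) - cnj \<zeta> * (w - c) = 0"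
    then have "of_real (\<rho>\<^sup>2) = cnj \<zeta> * (w - c)" by simp
    then have "\<rho>\<^sup>2 = norm \<zeta> * norm (w - c)"
      by (metis abs_power2 complex_mod_cnj norm_mult norm_of_real)
    also have "\<dots> \<le> norm \<zeta> * \<rho>"
      using that by (intro mult_left_mono) (auto simp: dist_norm norm_minus_commute)
    also have "\<dots> < \<rho> * \<rho>" using \<zeta> \<rho> by simp
    finally show False by (simp add: power2_eq_square)
  qed
  \<comment> \<open>With \<open>s = w - c\<close>, substituting
    \<open>cnj s = \<rho>\<^sup>2 / s\<close> into the conjugated kernel and clearing powers of
    \<open>s\<close> gives the second factor of \<open>h\<close>.\<close>
  define h where "h w = F w * (of_real (\<rho>\<^sup>2) * (w - c) ^ n / (of_real (\<rho>\<^sup>2) - cnj \<zeta> * (w - c)) ^ Suc n)" for w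
  have "((\<lambda>t. h (circlepath c \<rho> t)) has_integral h c) {0..1}"
    unfolding h_def using nz \<rho>
    by (intro holomorphic_circle_mean continuous_intros holomorphic_intros assms) auto
  then have "((\<lambda>t. cnj (h (circlepath c \<rho> t))) has_integral cnj (h c)) {0..1}"
    using has_integral_linear[OF _ bounded_linear_cnj] by (auto simp: o_def)
  moreover have "cnj (h (circlepath c \<rho> t)) =
      cnj (F (circlepath c \<rho> t)) * ((circlepath c \<rho> t - c) / (circlepath c \<rho> t - z) ^ Suc n)" for t
  proof -
    define s where "s = circlepath c \<rho> t - c"
    have s: "norm s = \<rho>" using norm_circlepath_minus_center \<rho> by (simp add: s_def)
    then have "s \<noteq> 0" using \<rho> by auto
    define P where "P = complex_of_real (\<rho>\<^sup>2)"
    have P: "P = s * cnj s" using complex_norm_square[of s] unfolding s P_def .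
    have w: "circlepath c \<rho> t - z = s - \<zeta>" by (simp add: s_def \<zeta>_def)
    have "cnj (P * s ^ n / (P - cnj \<zeta> * s) ^ Suc n) = P * cnj s ^ n / (P - \<zeta> * cnj s) ^ Suc n"
      by (simp add: P_def)
    also have "P - \<zeta> * cnj s = (s - \<zeta>) * cnj s" by (simp add: P algebra_simps)
    also have "P * cnj s ^ n / ((s - \<zeta>) * cnj s) ^ Suc n =
        s * cnj s * cnj s ^ n / ((s - \<zeta>) * cnj s) ^ Suc n"
      by (simp only: P)
    also have "\<dots> = s / (s - \<zeta>) ^ Suc n"
      using \<open>s \<noteq> 0\<close> by (simp add: power_mult_distrib)
    finally have "cnj (P * s ^ n / (P - cnj \<zeta> * s) ^ Suc n) = s / (s - \<zeta>) ^ Suc n" .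
    then show ?thesis
      unfolding h_def w complex_cnj_mult[of "F _"] P_def[symmetric] s_def[symmetric] by (rule arg_cong)
  qed
  \<comment> \<open>At the centre the factor \<open>(w - c) ^ n\<close> becomes
    \<open>0 ^ n\<close>, which is \<open>1\<close> for \<open>n = 0\<close> and \<open>0\<close>
    otherwise.\<close>
  moreover have "cnj (h c) = (if n = 0 then cnj (F c) else 0)"
    using \<rho> by (simp add: h_def)
  ultimately show ?thesis by simp
qed

text \<open>Adding the two means replaces \<open>F\<close> by \<open>F + cnj F = 2 * Re F\<close>,
  so the values of \<open>F\<close> on the circle enter only through their real part.\<close>

lemma Schwarz_circle_mean:
  assumes "continuous_on (cball c \<rho>) F" "F holomorphic_on ball c \<rho>" "z \<in> ball c \<rho>"
  shows "((\<lambda>t. of_real (2 * Re (F (circlepath c \<rho> t))) *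
        ((circlepath c \<rho> t - c) / (circlepath c \<rho> t - z) ^ Suc n))
      has_integral (deriv ^^ n) F z / fact n + (if n = 0 then cnj (F c) else 0)) {0..1}"
  using has_integral_add[OF Cauchy_higher_derivative_circle_mean[OF assms, of n]
      Cauchy_higher_derivative_circle_mean_cnj[OF assms, of n]]
  by (simp only: flip: distrib_right complex_add_cnj)

lemma continuous_on_circlepath: "continuous_on A (circlepath c \<rho>)"
  unfolding circlepath by (intro continuous_intros)

lemma circlepath_mem_cball: "0 \<le> \<rho> \<Longrightarrow> circlepath c \<rho> t \<in> cball c \<rho>"
  using norm_circlepath_minus_center[of c \<rho> t] by (simp add: dist_norm norm_minus_commute)

text \<open>A point of the circle has distance \<open>\<rho>\<close> from \<open>c\<close>, hence at
  least \<open>\<rho> - r\<close> from \<open>z\<close>.\<close>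

lemma circlepath_kernel_bound:
  assumes "norm (z - c) \<le> r" "r < \<rho>"
  shows "norm (1 / (circlepath c \<rho> t - z) ^ k) \<le> 1 / (\<rho> - r) ^ k"
proof -
  have "0 \<le> \<rho>" using assms norm_ge_zero[of "z - c"] by linarith
  then have "\<rho> = norm ((circlepath c \<rho> t - z) + (z - c))"
    using norm_circlepath_minus_center[of c \<rho> t] by simp
  then have "\<rho> - r \<le> norm (circlepath c \<rho> t - z)"
    using assms(1) norm_triangle_ineq[of "circlepath c \<rho> t - z" "z - c"] by linarith
  then show ?thesis
    using assms(2) by (auto simp: norm_divide norm_power intro!: divide_left_mono power_mono mult_pos_pos zero_less_power)
qed

section \<open>Estimates on a single circle\<close>

context
  fixes F :: "complex \<Rightarrow> complex" and c z :: complex and \<rho> r :: real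
  assumes cont: "continuous_on (cball c \<rho>) F" and hol: "F holomorphic_on ball c \<rho>"
    and z: "norm (z - c) \<le> r" and r: "r < \<rho>"
begin

lemma \<rho>_pos: "0 < \<rho>"
  using z r norm_ge_zero[of "z - c"] by linarith

lemma z_mem_ball: "z \<in> ball c \<rho>"
  using z r by (simp add: dist_norm norm_minus_commute)

lemma Re_continuous_on_circlepath: "continuous_on {0..1} (\<lambda>t. Re (F (circlepath c \<rho> t)))"
  using \<rho>_pos circlepath_mem_cball
  by (intro continuous_intros continuous_on_compose2[OF cont] continuous_on_circlepath) auto

text \<open>Turns a bound \<open>b\<close> on the kernel into a bound on the integral. The value
  type is left general so that it serves both the complex derivatives of positive order and the real
  integrals of order zero.\<close>

lemma integral_bound_by_abs_mean:
  fixes g :: "real \<Rightarrow> 'a::banach"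
  assumes g: "(g has_integral I) {0..1}"
    and le: "\<And>t. norm (g t) \<le> 2 * \<bar>Re (F (circlepath c \<rho> t))\<bar> * b"
  shows "norm I \<le> 2 * b * integral {0..1} (\<lambda>t. \<bar>Re (F (circlepath c \<rho> t))\<bar>)"
proof -
  have "norm (integral {0..1} g) \<le> integral {0..1} (\<lambda>t. 2 * b * \<bar>Re (F (circlepath c \<rho> t))\<bar>)"
  proof (rule integral_norm_bound_integral)
    show "g integrable_on {0..1}" using g by blast
    show "(\<lambda>t. 2 * b * \<bar>Re (F (circlepath c \<rho> t))\<bar>) integrable_on {0..1}"
      by (intro integrable_continuous_real continuous_intros Re_continuous_on_circlepath)
    show "norm (g t) \<le> 2 * b * \<bar>Re (F (circlepath c \<rho> t))\<bar>" for t
      using le[of t] by (simp add: mult_ac)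
  qed
  then show ?thesis using g by (simp add: integral_unique)
qed

lemma higher_deriv_le_abs_mean:
  assumes "0 < n"
  shows "norm ((deriv ^^ n) F z)
    \<le> 2 * (fact n * \<rho> / (\<rho> - r) ^ Suc n) * integral {0..1} (\<lambda>t. \<bar>Re (F (circlepath c \<rho> t))\<bar>)"
proof -
  have "norm (of_real (2 * Re (F (circlepath c \<rho> t))) *
        ((circlepath c \<rho> t - c) / (circlepath c \<rho> t - z) ^ Suc n))
      \<le> 2 * \<bar>Re (F (circlepath c \<rho> t))\<bar> * (\<rho> / (\<rho> - r) ^ Suc n)" for t
  proof -
    have "norm ((circlepath c \<rho> t - c) * (1 / (circlepath c \<rho> t - z) ^ Suc n))
        \<le> \<rho> * (1 / (\<rho> - r) ^ Suc n)"
      unfolding norm_mult norm_circlepath_minus_center using circlepath_kernel_bound[OF z r, of t "Suc n"] \<rho>_pos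
      by (intro mult_mono) auto
    then show ?thesis
      unfolding norm_mult[of "of_real _"] by (intro mult_mono) auto
  qed
  from integral_bound_by_abs_mean[OF Schwarz_circle_mean[OF cont hol z_mem_ball] this]
  have "norm ((deriv ^^ n) F z / fact n)
      \<le> 2 * (\<rho> / (\<rho> - r) ^ Suc n) * integral {0..1} (\<lambda>t. \<bar>Re (F (circlepath c \<rho> t))\<bar>)"
    using assms by simp
  then show ?thesis
    by (simp add: norm_divide field_simps)
qed

text \<open>The Schwarz formula with \<open>n = 0\<close> represents
  \<open>Re (F z) + Re (F c)\<close>; subtracting it from twice the mean value formula represents
  \<open>Re (F c) - Re (F z)\<close>. Upper bounds for both control \<open>Re (F z)\<close> with
  either sign and leave the mean \<open>Re (F c)\<close> as a subtracted term.\<close>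

lemma abs_Re_le_abs_mean:
  "\<bar>Re (F z)\<bar> \<le> - integral {0..1} (\<lambda>t. Re (F (circlepath c \<rho> t)))
    + 2 * (\<rho> / (\<rho> - r)) * integral {0..1} (\<lambda>t. \<bar>Re (F (circlepath c \<rho> t))\<bar>)"
proof -
  have Re_of_real_mult: "Re (of_real a * b) = a * Re b" for a b
    by simp
  define w where "w = circlepath c \<rho>"
  define K where "K t = Re ((w t - c) / (w t - z))" for t
  \<comment> \<open>With \<open>w t = z\<close> the convention \<open>x / 0 = 0\<close> would
    falsify the formula for \<open>1 - K t\<close> below.\<close>
  have wz: "w t \<noteq> z" for t
    using norm_circlepath_minus_center[of c \<rho> t] z r \<rho>_pos unfolding w_def by auto
  have M: "((\<lambda>t. Re (F (w t))) has_integral Re (F c)) {0..1}"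
    using has_integral_Re[OF holomorphic_circle_mean[OF cont hol \<rho>_pos]] by (simp add: w_def)
  have S: "((\<lambda>t. 2 * Re (F (w t)) * K t) has_integral Re (F z) + Re (F c)) {0..1}"
    using has_integral_Re[OF Schwarz_circle_mean[OF cont hol z_mem_ball, of 0]]
    by (simp add: w_def K_def Re_of_real_mult del: of_real_mult times_divide_eq_right)
  have D: "((\<lambda>t. 2 * Re (F (w t)) * (1 - K t)) has_integral Re (F c) - Re (F z)) {0..1}"
    using has_integral_diff[OF has_integral_mult_right[OF M, of 2] S]
    by (simp add: algebra_simps)
  have inv: "norm (1 / (w t - z)) \<le> 1 / (\<rho> - r)" for t
    using circlepath_kernel_bound[OF z r, of t 1] by (simp add: w_def)
  have K: "\<bar>K t\<bar> \<le> \<rho> / (\<rho> - r)" for t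
  proof -
    have "\<bar>K t\<bar> \<le> norm ((w t - c) * (1 / (w t - z)))"
      unfolding K_def times_divide_eq_right mult_1_right by (rule abs_Re_le_cmod)
    also have "\<dots> \<le> \<rho> * (1 / (\<rho> - r))"
      unfolding norm_mult w_def norm_circlepath_minus_center using inv[of t] \<rho>_pos
      by (intro mult_mono) (auto simp: w_def)
    finally show ?thesis by simp
  qed
  have K': "\<bar>1 - K t\<bar> \<le> \<rho> / (\<rho> - r)" for t
  proof -
    \<comment> \<open>The numerator becomes \<open>c - z\<close>, of modulus at most
      \<open>r < \<rho>\<close>, so the bound found for \<open>K\<close> holds again.\<close>
    have "1 - K t = Re ((c - z) * (1 / (w t - z)))"
      unfolding K_def using wz[of t] by (simp add: field_simps flip: one_complex.sel(1) minus_complex.sel(1))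
    also have "\<bar>\<dots>\<bar> \<le> norm ((c - z) * (1 / (w t - z)))"
      by (rule abs_Re_le_cmod)
    also have "\<dots> \<le> \<rho> * (1 / (\<rho> - r))"
      unfolding norm_mult using inv[of t] z r \<rho>_pos
      by (intro mult_mono) (auto simp: norm_minus_commute)
    finally show ?thesis by simp
  qed
  have "\<bar>Re (F z) + Re (F c)\<bar> \<le> 2 * (\<rho> / (\<rho> - r)) * integral {0..1} (\<lambda>t. \<bar>Re (F (w t))\<bar>)"
    unfolding w_def
    by (rule integral_bound_by_abs_mean[OF S[unfolded w_def], unfolded real_norm_def])
      (use K in \<open>simp add: abs_mult mult_left_mono del: times_divide_eq_right\<close>)
  moreover have "\<bar>Re (F c) - Re (F z)\<bar> \<le> 2 * (\<rho> / (\<rho> - r)) * integral {0..1} (\<lambda>t. \<bar>Re (F (w t))\<bar>)"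
    unfolding w_def
    by (rule integral_bound_by_abs_mean[OF D[unfolded w_def], unfolded real_norm_def])
      (use K' in \<open>simp add: abs_mult mult_left_mono del: times_divide_eq_right\<close>)
  moreover have "integral {0..1} (\<lambda>t. Re (F (w t))) = Re (F c)"
    using M by (rule integral_unique)
  ultimately show ?thesis
    unfolding w_def by linarith
qed

end

section \<open>Derivative estimates\<close>

text \<open>A constant is the real part of a constant holomorphic function on the whole
  plane.\<close>

lemma D_mixed_const: "D_mixed a1 a2 (\<lambda>_. k) p = (if a1 + a2 = 0 then k else 0)"
  using D_mixed_Re_holomorphic[of UNIV "\<lambda>_. of_real k" "\<lambda>_. k" p a1 a2]
  by (auto simp: higher_deriv_const)

lemma complex_of_point_circle_path:
  "complex_of_point (circle_path c \<rho> t) = circlepath (complex_of_point c) \<rho> t"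
  by (simp add: circlepath circle_path_def complex_eq_iff Re_exp Im_exp)

lemma dist_circle_path [simp]: "dist c (circle_path c \<rho> t) = \<bar>\<rho>\<bar>"
  by (simp add: circle_path_def dist_norm norm_prod_def power_mult_distrib flip: distrib_left)

lemma continuous_on_circle_path: "continuous_on A (circle_path c \<rho>)"
  unfolding circle_path_def by (intro continuous_intros)

text \<open>The parametrization has constant speed \<open>2 * pi * \<rho>\<close>.\<close>

lemma circle_integral_eq_mean:
  assumes "0 \<le> \<rho>"
  shows "circle_integral c \<rho> w = 2 * pi * \<rho> * integral {0..1} (\<lambda>t. w (circle_path c \<rho> t))"
proof -
  have "vector_derivative (circle_path c \<rho>) (at t within {0..1})
      = \<rho> *\<^sub>R (- 2 * pi * sin (2 * pi * t), 2 * pi * cos (2 * pi * t))" if "t \<in> {0..1}" for t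
  proof (rule vector_derivative_within_closed_interval)
    show "(circle_path c \<rho> has_vector_derivative
        \<rho> *\<^sub>R (- 2 * pi * sin (2 * pi * t), 2 * pi * cos (2 * pi * t))) (at t within {0..1})"
      unfolding circle_path_def
      by (auto simp: has_vector_derivative_def intro!: derivative_eq_intros)
  qed (use that in auto)
  moreover have "norm (\<rho> *\<^sub>R (- 2 * pi * sin s, 2 * pi * cos s)) = 2 * pi * \<rho>" for s
  proof -
    have "(2 * pi * sin s)\<^sup>2 + (2 * pi * cos s)\<^sup>2 = (2 * pi)\<^sup>2"
      by (simp add: power_mult_distrib flip: distrib_left)
    then have "norm (- 2 * pi * sin s, 2 * pi * cos s) = 2 * pi"
      by (simp add: norm_prod_def real_sqrt_mult)
    then show ?thesis using assms by (simp only: norm_scaleR) simp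
  qed
  ultimately have "norm (vector_derivative (circle_path c \<rho>) (at t within {0..1})) = 2 * pi * \<rho>"
    if "t \<in> {0..1}" for t
    using that by metis
  then have "circle_integral c \<rho> w = integral {0..1} (\<lambda>t. 2 * pi * \<rho> * w (circle_path c \<rho> t))"
    unfolding circle_integral_def arc_length_integral_def
    by (intro integral_cong) (simp add: mult_ac)
  then show ?thesis by simp
qed

text \<open>This permits the passage to the boundary circle: the integrand is jointly continuous in
  radius and parameter on a compact rectangle that includes the radius \<open>L\<close>.\<close>

lemma continuous_on_circle_mean:
  fixes w :: "real \<times> real \<Rightarrow> 'a::banach"
  assumes "continuous_on (cball c L) w"
  shows "continuous_on {0..L} (\<lambda>\<rho>. integral {0..1} (\<lambda>t. w (circle_path c \<rho> t)))"
proof -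
  have "continuous_on ({0..L} \<times> {0..1}) (\<lambda>q. w (circle_path c (fst q) (snd q)))"
  proof (rule continuous_on_compose2[OF assms])
    show "continuous_on ({0..L} \<times> {0..1}) (\<lambda>q. circle_path c (fst q) (snd q))"
      unfolding circle_path_def by (intro continuous_intros)
  qed auto
  then show ?thesis
    using integral_continuous_on_param[of "{0..L}" 0 1 "\<lambda>\<rho> t. w (circle_path c \<rho> t)"]
    by (simp add: case_prod_beta')
qed

text \<open>The radius stays strictly below \<open>L\<close> because \<open>F\<close> is holomorphic
  in the open disk and, unlike \<open>u\<close>, need not extend continuously to its
  boundary.\<close>

lemma D_mixed_bound_inner:
  assumes "C_infinity_on (ball c L) u" "\<And>p. p \<in> ball c L \<Longrightarrow> laplacian u p = 0"
    and p: "dist c p \<le> r" and \<rho>: "r < \<rho>" "\<rho> < L"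
  shows "\<bar>D_mixed a1 a2 u p\<bar>
    \<le> (if a1 + a2 = 0 then - integral {0..1} (\<lambda>t. u (circle_path c \<rho> t)) else 0)
      + 2 * (fact (a1 + a2) * \<rho> / (\<rho> - r) ^ (a1 + a2 + 1))
        * integral {0..1} (\<lambda>t. \<bar>u (circle_path c \<rho> t)\<bar>)"
proof -
  obtain F where F: "F holomorphic_on ball (complex_of_point c) L"
    and u: "\<And>p. p \<in> ball c L \<Longrightarrow> u p = Re (F (complex_of_point p))"
    using harmonic_eq_Re_holomorphic[OF assms(1,2)] by metis
  define z where "z = complex_of_point p"
  have z: "norm (z - complex_of_point c) \<le> r"
    using p dist_complex_of_point[of c p] unfolding z_def by (simp add: dist_norm norm_minus_commute)
  have F': "F holomorphic_on ball (complex_of_point c) \<rho>"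
    "continuous_on (cball (complex_of_point c) \<rho>) F"
    using F \<rho>(2) by (auto intro!: holomorphic_on_imp_continuous_on elim!: holomorphic_on_subset)
  have "0 \<le> r" using p zero_le_dist order_trans by blast
  then have mean: "Re (F (circlepath (complex_of_point c) \<rho> t)) = u (circle_path c \<rho> t)" for t
    using u[of "circle_path c \<rho> t"] \<rho> by (simp add: complex_of_point_circle_path)
  define n where "n = a1 + a2"
  have D: "D_mixed a1 a2 u p = Re (\<i> ^ a2 * (deriv ^^ n) F z)"
    unfolding z_def n_def using p \<rho> u
    by (intro D_mixed_Re_holomorphic[OF open_ball F]) auto
  show ?thesis
  proof (cases "n = 0")
    case True
    then show ?thesis
      using abs_Re_le_abs_mean[OF F'(2,1) z \<rho>(1)] D by (simp add: mean n_def)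
  next
    case False
    \<comment> \<open>The factor \<open>\<i> ^ a2\<close> has modulus \<open>1\<close>, so the bound
      does not depend on how the order splits into \<open>a1\<close> and \<open>a2\<close>.\<close>
    have "\<bar>D_mixed a1 a2 u p\<bar> \<le> norm (\<i> ^ a2 * (deriv ^^ n) F z)"
      unfolding D by (rule abs_Re_le_cmod)
    also have "\<dots> = norm ((deriv ^^ n) F z)" by (simp add: norm_mult norm_power)
    also have "\<dots> \<le> 2 * (fact n * \<rho> / (\<rho> - r) ^ Suc n)
        * integral {0..1} (\<lambda>t. \<bar>u (circle_path c \<rho> t)\<bar>)"
      using higher_deriv_le_abs_mean[OF F'(2,1) z \<rho>(1), of n] False by (simp add: mean)
    finally show ?thesis using False by (auto simp: n_def)
  qed
qed

lemma D_mixed_bound: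
  assumes u: "harmonic_in_disk c L u" and p: "dist c p \<le> r" and r: "r < L"
  shows "\<bar>D_mixed a1 a2 u p\<bar>
    \<le> D_mixed a1 a2 (\<lambda>_. -1 / (2 * pi * L) * circle_integral c L u) c
      + fact (a1 + a2) / (pi * (L - r) ^ (a1 + a2 + 1)) * circle_integral c L (\<lambda>p. \<bar>u p\<bar>)"
proof -
  \<comment> \<open>Starting at the midpoint keeps \<open>\<rho> - r\<close> away from
    \<open>0\<close>, so the bound \<open>B\<close> is continuous on \<open>{s..L}\<close> and the
    estimate on the open interval passes to its endpoint \<open>L\<close>.\<close>
  define s where "s = (r + L) / 2"
  have "0 \<le> r" using p zero_le_dist order_trans by blast
  have s: "r < s" "s < L" using r by (auto simp: s_def)
  define M where "M \<rho> = integral {0..1} (\<lambda>t. u (circle_path c \<rho> t))" for \<rho>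
  define N where "N \<rho> = integral {0..1} (\<lambda>t. \<bar>u (circle_path c \<rho> t)\<bar>)" for \<rho>
  define B where "B \<rho> = (if a1 + a2 = 0 then - M \<rho> else 0)
      + 2 * (fact (a1 + a2) * \<rho> / (\<rho> - r) ^ (a1 + a2 + 1)) * N \<rho>" for \<rho>
  have cont: "continuous_on (cball c L) u" using u by (simp add: harmonic_in_disk_def)
  have "continuous_on {0..L} M" "continuous_on {0..L} N"
    unfolding M_def N_def using cont
    by (intro continuous_on_circle_mean continuous_on_rabs; assumption)+
  moreover have "{s..L} \<subseteq> {0..L}" using s \<open>0 \<le> r\<close> by auto
  ultimately have "continuous_on {s..L} M" "continuous_on {s..L} N"
    using continuous_on_subset by blast+
  then have "continuous_on {s..L} B"
    unfolding B_def using s by (cases "a1 + a2 = 0") (auto intro!: continuous_intros)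
  moreover have "\<bar>D_mixed a1 a2 u p\<bar> \<le> B \<rho>" if "\<rho> \<in> {s<..<L}" for \<rho>
    unfolding B_def M_def N_def using that s u
    by (intro D_mixed_bound_inner[OF _ _ p]) (auto simp: harmonic_in_disk_def)
  ultimately have "\<bar>D_mixed a1 a2 u p\<bar> \<le> B L"
    using continuous_ge_on_closure[of "{s<..<L}" B L "\<bar>D_mixed a1 a2 u p\<bar>"] s
    by (simp add: closure_greaterThanLessThan)
  \<comment> \<open>Each mean is its circle integral divided by \<open>2 * pi * L\<close>; in the
    second term this cancels \<open>2 * L\<close> and leaves \<open>1 / pi\<close>.\<close>
  also have "B L = D_mixed a1 a2 (\<lambda>_. -1 / (2 * pi * L) * circle_integral c L u) c
      + fact (a1 + a2) / (pi * (L - r) ^ (a1 + a2 + 1)) * circle_integral c L (\<lambda>p. \<bar>u p\<bar>)"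
    unfolding D_mixed_const B_def M_def N_def
    using r \<open>0 \<le> r\<close> by (simp add: circle_integral_eq_mean)
  finally show ?thesis .
qed

lemma circle_integral_abs_le_C_norm:
  assumes "0 \<le> L" "continuous_on (cball c L) u"
  shows "circle_integral c L (\<lambda>p. \<bar>u p\<bar>) \<le> 2 * pi * L * C_norm (cball c L) u"
proof -
  have le: "\<bar>u (circle_path c L t)\<bar> \<le> C_norm (cball c L) u" for t
    using C_norm_attained[OF compact_cball _ assms(2)] assms(1) by force
  have "continuous_on {0..1} (\<lambda>t. \<bar>u (circle_path c L t)\<bar>)"
    using assms(1)
    by (intro continuous_on_rabs continuous_on_compose2[OF assms(2)] continuous_on_circle_path) auto
  then have "integral {0..1} (\<lambda>t. \<bar>u (circle_path c L t)\<bar>) \<le> integral {0..1::real} (\<lambda>t. C_norm (cball c L) u)"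
    using le by (intro integral_le integrable_continuous_real) auto
  then show ?thesis
    using assms(1) by (simp add: circle_integral_eq_mean mult_left_mono)
qed

section \<open>Mean value property and maximum principle\<close>

lemma harmonic_in_disk_subset:
  assumes "harmonic_in_disk c L u" "ball c' L' \<subseteq> ball c L" "cball c' L' \<subseteq> cball c L"
  shows "harmonic_in_disk c' L' u"
  using assms unfolding harmonic_in_disk_def C_infinity_on_def
  by (auto intro: continuous_on_subset C_k_on_subset)

text \<open>The real part of the mean value formula for the holomorphic function whose real part is
  \<open>u\<close>.\<close>

lemma harmonic_mean_value:
  assumes "harmonic_in_disk c L u" "0 < \<rho>" "\<rho> < L"
  shows "((\<lambda>t. u (circle_path c \<rho> t)) has_integral u c) {0..1}"
proof -
  obtain F where F: "F holomorphic_on ball (complex_of_point c) L"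
    and u: "\<And>p. p \<in> ball c L \<Longrightarrow> u p = Re (F (complex_of_point p))"
    using harmonic_eq_Re_holomorphic[of c L u] assms(1) unfolding harmonic_in_disk_def by metis
  have "F holomorphic_on ball (complex_of_point c) \<rho>"
    "continuous_on (cball (complex_of_point c) \<rho>) F"
    using F assms(3) by (auto intro!: holomorphic_on_imp_continuous_on elim!: holomorphic_on_subset)
  then have "((\<lambda>t. Re (F (circlepath (complex_of_point c) \<rho> t))) has_integral
      Re (F (complex_of_point c))) {0..1}"
    using holomorphic_circle_mean has_integral_Re assms(2) by blast
  then show ?thesis
    using u assms(2,3) by (simp add: complex_of_point_circle_path)
qed

text \<open>The unit vector from \<open>c\<close> towards \<open>p\<close> has an angle in
  \<open>[0, 2 * pi]\<close>. This allows an identity along the parameter to be read at a prescribed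
  point of the circle.\<close>

lemma circle_path_surj:
  assumes "dist c p = \<rho>" "0 < \<rho>"
  obtains t where "t \<in> {0..1}" "circle_path c \<rho> t = p"
proof -
  define v where "v = (p - c) /\<^sub>R \<rho>"
  have "norm v = 1" using assms by (simp add: v_def dist_norm norm_minus_commute)
  then have "(fst v)\<^sup>2 + (snd v)\<^sup>2 = 1" by (simp add: norm_prod_def)
  then obtain s where s: "0 \<le> s" "s \<le> 2 * pi" "fst v = cos s" "snd v = sin s"
    using sincos_total_2pi_le by blast
  have "\<rho> *\<^sub>R v = p - c" using assms(2) by (simp add: v_def)
  moreover have "v = (cos s, sin s)" using s by (simp add: prod_eq_iff)
  ultimately have "circle_path c \<rho> (s / (2 * pi)) = p" by (simp add: circle_path_def)
  then show thesis using s by (intro that[of "s / (2 * pi)"]) auto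
qed

text \<open>Among the maximum points of \<open>\<bar>u\<bar>\<close> take one farthest from the centre: if it were interior, the
  mean value property would make every point of a small circle around it a maximum point, and one
  of these is farther out.\<close>

lemma harmonic_abs_max_on_sphere:
  assumes u: "harmonic_in_disk c R u" and R: "0 < R"
  obtains s where "s \<in> sphere c R" "\<And>q. q \<in> cball c R \<Longrightarrow> \<bar>u q\<bar> \<le> \<bar>u s\<bar>"
proof -
  have cont: "continuous_on (cball c R) u" using u by (simp add: harmonic_in_disk_def)
  then have cont': "continuous_on (cball c R) (\<lambda>q. \<bar>u q\<bar>)" by (rule continuous_on_rabs)
  then obtain p0 where p0: "p0 \<in> cball c R" "\<And>q. q \<in> cball c R \<Longrightarrow> \<bar>u q\<bar> \<le> \<bar>u p0\<bar>"
    using continuous_attains_sup[of "cball c R"] R by force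
  define K where "K = {q \<in> cball c R. \<bar>u q\<bar> = \<bar>u p0\<bar>}"
  have "closed K"
    unfolding K_def using cont' by (intro continuous_closed_preimage_constant) auto
  then have "compact K"
    using compact_Int_closed[OF compact_cball, of K c R] by (simp add: K_def Int_def conj_commute)
  moreover have "K \<noteq> {}" using p0(1) unfolding K_def by blast
  moreover have "continuous_on K (dist c)" by (intro continuous_intros)
  ultimately obtain p where p: "p \<in> K" "\<And>q. q \<in> K \<Longrightarrow> dist c q \<le> dist c p"
    using continuous_attains_sup by metis
  have "dist c p = R"
  proof (rule ccontr)
    assume "dist c p \<noteq> R"
    \<comment> \<open>The distance from \<open>p\<close> to the boundary circle: \<open>u\<close> is
      harmonic in the disk of radius \<open>e\<close> about \<open>p\<close>, and the circle of
      radius \<open>e / 2\<close> lies strictly inside it.\<close>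
    define e where "e = R - dist c p"
    have e: "0 < e" using p(1) \<open>dist c p \<noteq> R\<close> by (simp add: e_def K_def)
    define \<gamma> where "\<gamma> = circle_path p (e / 2)"
    have sub: "ball p e \<subseteq> ball c R" "cball p e \<subseteq> cball c R"
      by (simp_all add: e_def ball_subset_ball_iff cball_subset_cball_iff dist_commute)
    have \<gamma>: "\<gamma> t \<in> cball c R" for t
      using sub(2) e by (auto simp: \<gamma>_def subset_eq)
    then have le: "\<bar>u (\<gamma> t)\<bar> \<le> \<bar>u p\<bar>" for t
      using p0(2) p(1) by (simp add: K_def)
    have mean: "((\<lambda>t. u (\<gamma> t)) has_integral u p) {0..1}"
      unfolding \<gamma>_def using e
      by (intro harmonic_mean_value[OF harmonic_in_disk_subset[OF u sub]]) auto
    have cont\<gamma>: "continuous_on {0..1} (\<lambda>t. \<bar>u (\<gamma> t)\<bar>)"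
      using \<gamma> unfolding \<gamma>_def
      by (intro continuous_on_compose2[OF cont'] continuous_on_circle_path) auto
    then have cont_diff: "continuous_on {0..1} (\<lambda>t. \<bar>u p\<bar> - \<bar>u (\<gamma> t)\<bar>)"
      by (rule continuous_on_diff[OF continuous_on_const])
    \<comment> \<open>The mean value property bounds \<open>\<bar>u p\<bar>\<close> by the mean of
      \<open>\<bar>u\<bar>\<close> on the circle, while \<open>\<bar>u p\<bar>\<close> is the
      maximum; the continuous nonnegative difference thus has integral zero and vanishes.\<close>
    have "norm (integral {0..1} (\<lambda>t. u (\<gamma> t))) \<le> integral {0..1} (\<lambda>t. \<bar>u (\<gamma> t)\<bar>)"
      using mean integrable_continuous_real[OF cont\<gamma>]
      by (intro integral_norm_bound_integral) auto
    then have "\<bar>u p\<bar> \<le> integral {0..1} (\<lambda>t. \<bar>u (\<gamma> t)\<bar>)"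
      using mean by (simp add: integral_unique)
    then have "integral {0..1} (\<lambda>t. \<bar>u p\<bar> - \<bar>u (\<gamma> t)\<bar>) \<le> 0"
      using cont\<gamma> by (subst integral_diff) (auto intro: integrable_continuous_real)
    moreover have "0 \<le> integral {0..1} (\<lambda>t. \<bar>u p\<bar> - \<bar>u (\<gamma> t)\<bar>)"
      using le integrable_continuous_real[OF cont_diff] by (intro integral_nonneg) auto
    ultimately have "integral {0..1} (\<lambda>t. \<bar>u p\<bar> - \<bar>u (\<gamma> t)\<bar>) = 0" by linarith
    then have eq: "\<bar>u p\<bar> - \<bar>u (\<gamma> t)\<bar> = 0" if "t \<in> {0..1}" for t
      using that le integral_eq_0_iff[OF cont_diff] by auto
    \<comment> \<open>\<open>v\<close> points radially away from \<open>c\<close>, so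
      \<open>q\<close> lies \<open>e / 2\<close> farther out than \<open>p\<close>; at
      \<open>p = c\<close> every direction serves and \<open>(1, 0)\<close> is chosen.\<close>
    define v where "v = (if p = c then (1, 0) else (p - c) /\<^sub>R norm (p - c))"
    have v: "norm v = 1" "p - c = norm (p - c) *\<^sub>R v" by (auto simp: v_def simp flip: zero_prod_def)
    define q where "q = p + (e / 2) *\<^sub>R v"
    have "dist p q = e / 2" using v e by (simp add: q_def dist_norm)
    then obtain t where t: "t \<in> {0..1}" "\<gamma> t = q"
      using circle_path_surj[of p q "e / 2"] e unfolding \<gamma>_def by auto
    have "q \<in> K"
      using eq[OF t(1)] t(2) \<gamma>[of t] p(1) by (simp add: K_def)
    then have "dist c q \<le> dist c p" by (rule p(2))
    moreover have "q - c = (norm (p - c) + e / 2) *\<^sub>R v"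
      using v(2) by (simp add: q_def scaleR_left_distrib)
    then have "norm (q - c) = norm (p - c) + e / 2" using v(1) e by simp
    ultimately show False using e by (simp add: dist_norm norm_minus_commute)
  qed
  then show thesis
    using p(1) p0(2) that[of p] by (simp add: K_def)
qed

text \<open>The case \<open>r = 0\<close> of the general estimate, where the mean term vanishes
  because the order is positive; the second inequality bounds the integral by length times
  maximum.\<close>

lemma D_mixed_center_bound:
  assumes "harmonic_in_disk c L u" "0 < L" "1 \<le> a1 + a2"
  shows "\<bar>D_mixed a1 a2 u c\<bar>
      \<le> fact (a1 + a2) / (pi * L ^ (a1 + a2 + 1)) * circle_integral c L (\<lambda>p. \<bar>u p\<bar>)"
    and "fact (a1 + a2) / (pi * L ^ (a1 + a2 + 1)) * circle_integral c L (\<lambda>p. \<bar>u p\<bar>)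
      \<le> 2 * fact (a1 + a2) / L ^ (a1 + a2) * C_norm (cball c L) u"
proof -
  show "\<bar>D_mixed a1 a2 u c\<bar>
      \<le> fact (a1 + a2) / (pi * L ^ (a1 + a2 + 1)) * circle_integral c L (\<lambda>p. \<bar>u p\<bar>)"
    using D_mixed_bound[OF assms(1), of c 0 a1 a2] assms(2,3)
    by (auto simp: D_mixed_const split: if_splits)
  have "fact (a1 + a2) / (pi * L ^ (a1 + a2 + 1)) * circle_integral c L (\<lambda>p. \<bar>u p\<bar>)
      \<le> fact (a1 + a2) / (pi * L ^ (a1 + a2 + 1)) * (2 * pi * L * C_norm (cball c L) u)"
    using assms(1,2) unfolding harmonic_in_disk_def
    by (intro mult_left_mono circle_integral_abs_le_C_norm) auto
  then show "fact (a1 + a2) / (pi * L ^ (a1 + a2 + 1)) * circle_integral c L (\<lambda>p. \<bar>u p\<bar>)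
      \<le> 2 * fact (a1 + a2) / L ^ (a1 + a2) * C_norm (cball c L) u"
    using assms(2) by (simp add: field_simps)
qed

theorem corollary4p8:
  shows "(\<forall>(x0 :: real \<times> real) (L :: real) (u :: real \<times> real \<Rightarrow> real).
            0 < L \<longrightarrow> harmonic_in_disk x0 L u \<longrightarrow>
            (\<forall>(r :: real) (a1 :: nat) (a2 :: nat). 0 \<le> r \<longrightarrow> r < L \<longrightarrow>
               C_norm (cball x0 r) (D_mixed a1 a2 u)
                 \<le> D_mixed a1 a2 (\<lambda>_. -1 / (2 * pi * L) * circle_integral x0 L u) x0
                   + fact (a1 + a2) / (pi * (L - r) ^ (a1 + a2 + 1))
                     * circle_integral x0 L (\<lambda>p. \<bar>u p\<bar>)) \<and>
            (\<forall>(a1 :: nat) (a2 :: nat). 1 \<le> a1 + a2 \<longrightarrow>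
               \<bar>D_mixed a1 a2 u x0\<bar>
                 \<le> fact (a1 + a2) / (pi * L ^ (a1 + a2 + 1))
                     * circle_integral x0 L (\<lambda>p. \<bar>u p\<bar>) \<and>
               fact (a1 + a2) / (pi * L ^ (a1 + a2 + 1))
                   * circle_integral x0 L (\<lambda>p. \<bar>u p\<bar>)
                 \<le> 2 * fact (a1 + a2) / L ^ (a1 + a2) * C_norm (cball x0 L) u))
       \<and>
         (\<forall>(R :: real) (g :: real \<times> real \<Rightarrow> real) (u :: real \<times> real \<Rightarrow> real).
            0 < R \<longrightarrow> continuous_on (sphere 0 R) g \<longrightarrow> dirichlet_solution R g u \<longrightarrow>
            (\<forall>x\<in>ball 0 R. \<forall>(a1 :: nat) (a2 :: nat). 1 \<le> a1 + a2 \<longrightarrow>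
               \<bar>D_mixed a1 a2 u x\<bar>
                 \<le> fact (a1 + a2) / (pi * (R - norm x) ^ (a1 + a2 + 1))
                     * circle_integral x (R - norm x) (\<lambda>p. \<bar>u p\<bar>) \<and>
               fact (a1 + a2) / (pi * (R - norm x) ^ (a1 + a2 + 1))
                   * circle_integral x (R - norm x) (\<lambda>p. \<bar>u p\<bar>)
                 \<le> 2 * fact (a1 + a2) / (R - norm x) ^ (a1 + a2)
                     * C_norm (cball x (R - norm x)) u \<and>
               2 * fact (a1 + a2) / (R - norm x) ^ (a1 + a2) * C_norm (cball x (R - norm x)) u
                 \<le> 2 * fact (a1 + a2) / (R - norm x) ^ (a1 + a2) * C_norm (sphere 0 R) g))"
proof (intro conjI allI impI ballI)
  fix c :: "real \<times> real" and L r :: real and u :: "real \<times> real \<Rightarrow> real" and a1 a2 :: nat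
  assume "0 < L" and u: "harmonic_in_disk c L u" and r: "0 \<le> r" "r < L"
  \<comment> \<open>Nonemptiness lets the supremum inherit the pointwise bound; at
    \<open>r = 0\<close> the disk is just its centre.\<close>
  then have "cball c r \<noteq> {}" by simp
  then show "C_norm (cball c r) (D_mixed a1 a2 u)
      \<le> D_mixed a1 a2 (\<lambda>_. -1 / (2 * pi * L) * circle_integral c L u) c
        + fact (a1 + a2) / (pi * (L - r) ^ (a1 + a2 + 1)) * circle_integral c L (\<lambda>p. \<bar>u p\<bar>)"
    unfolding C_norm_def
    by (intro cSUP_least) (use D_mixed_bound[OF u] r in auto)
next
  fix c :: "real \<times> real" and L :: real and u :: "real \<times> real \<Rightarrow> real" and a1 a2 :: nat
  assume "0 < L" "harmonic_in_disk c L u" "1 \<le> a1 + a2"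
  then show "\<bar>D_mixed a1 a2 u c\<bar>
      \<le> fact (a1 + a2) / (pi * L ^ (a1 + a2 + 1)) * circle_integral c L (\<lambda>p. \<bar>u p\<bar>)"
    and "fact (a1 + a2) / (pi * L ^ (a1 + a2 + 1)) * circle_integral c L (\<lambda>p. \<bar>u p\<bar>)
      \<le> 2 * fact (a1 + a2) / L ^ (a1 + a2) * C_norm (cball c L) u"
    using D_mixed_center_bound by blast+
next
  fix R :: real and g u :: "real \<times> real \<Rightarrow> real" and x :: "real \<times> real" and a1 a2 :: nat
  assume R: "0 < R" and g: "continuous_on (sphere 0 R) g" and "dirichlet_solution R g u"
    and x: "x \<in> ball 0 R" and a: "1 \<le> a1 + a2"
  then have u: "harmonic_in_disk 0 R u" and ug: "\<And>p. p \<in> sphere 0 R \<Longrightarrow> u p = g p"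
    by (auto simp: dirichlet_solution_def)
  \<comment> \<open>The distance from \<open>x\<close> to the boundary circle, so that
    \<open>x\<close> becomes the centre of a disk in which \<open>u\<close> is harmonic.\<close>
  define e where "e = R - norm x"
  have e: "0 < e" using x by (simp add: e_def)
  have sub: "ball x e \<subseteq> ball 0 R" "cball x e \<subseteq> cball 0 R"
    by (simp_all add: e_def ball_subset_ball_iff cball_subset_cball_iff)
  have ux: "harmonic_in_disk x e u" using harmonic_in_disk_subset[OF u sub] .
  show "\<bar>D_mixed a1 a2 u x\<bar>
      \<le> fact (a1 + a2) / (pi * (R - norm x) ^ (a1 + a2 + 1))
        * circle_integral x (R - norm x) (\<lambda>p. \<bar>u p\<bar>)"
    and "fact (a1 + a2) / (pi * (R - norm x) ^ (a1 + a2 + 1))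
        * circle_integral x (R - norm x) (\<lambda>p. \<bar>u p\<bar>)
      \<le> 2 * fact (a1 + a2) / (R - norm x) ^ (a1 + a2) * C_norm (cball x (R - norm x)) u"
    using D_mixed_center_bound[OF ux e a] unfolding e_def .
  \<comment> \<open>By the maximum principle \<open>\<bar>u\<bar>\<close> is largest at a boundary
    point, where \<open>u\<close> equals \<open>g\<close>.\<close>
  obtain s where s: "s \<in> sphere 0 R" "\<And>q. q \<in> cball 0 R \<Longrightarrow> \<bar>u q\<bar> \<le> \<bar>u s\<bar>"
    using harmonic_abs_max_on_sphere[OF u R] by metis
  have "C_norm (cball x e) u \<le> \<bar>u s\<bar>"
    unfolding C_norm_def using e sub(2) s(2) by (intro cSUP_least) auto
  also have "\<bar>u s\<bar> \<le> C_norm (sphere 0 R) g"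
    using C_norm_attained[OF compact_sphere _ g] s(1) ug[OF s(1)] by (metis empty_iff)
  finally show "2 * fact (a1 + a2) / (R - norm x) ^ (a1 + a2) * C_norm (cball x (R - norm x)) u
      \<le> 2 * fact (a1 + a2) / (R - norm x) ^ (a1 + a2) * C_norm (sphere 0 R) g"
    unfolding e_def[symmetric] using e by (intro mult_left_mono) auto
qed

end
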